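(* Let $(\mu,P)$ be a time-homogeneous Markov chain on a countable state space $S$ (with $\sigma$-algebra $2^S$), and let $(A_1,B_1),\dots,(A_k,B_k)$ with $A_i,B_i\subseteq S$ be a Streett acceptance condition such that $$\mathsf P_\mu\Big(\bigcap_{i=1}^k\mathrm{Fin}(A_i)\cup\mathrm{Inf}(B_i)\Big)=p$$ for some $p\in(0,1]$. Then for every $\varepsilon>0$ there exist: - $I\subseteq S$; - $V_0:S\to\mathbb R_{\ge0}$ with $\mu V_0\le1-p+\varepsilon$; - $J_i\subseteq I\setminus A_i$; - $V_i,W_i:S\to\mathbb R_{\ge0}$; - $d_i:\mathbb R_{\ge0}\to\mathbb R_{>0}$; - $p_i:\mathbb R_{\ge0}\to(0,1]$ ($i=1,\dots,k$); such that, for every $i=1,\dots,k$: 1. $\forall s\notin A_i$: $PV_i(s)\le V_i(s)$; 2. $\forall s\in A_i$: $V_i(s)\ge1$; 3. $\exists\gamma_i>0\ \forall s\in J_i$: $V_i(s)\le1-\gamma_i$; 4. $\forall s\in I\setminus(B_i\cup J_i)$: $W_i(s)>0$ and $PW_i(s)\le W_i(s)$; 5. $\forall s\in I\cap(B_i\cup J_i)$: $W_i(s)=0$; 6. $\forall r>0\ \forall s\in I\setminus(B_i\cup J_i)$: if $W_i(s)=r$ then $P(s,\{s':W_i(s')\le r-d_i(r)\})\ge p_i(r)$; 7. $p_i$ and $d_i$ are non-increasing on $\mathbb R_{>0}$; and moreover $\forall s\in I$: $PV_0(s)\le V_0(s)$, and $\forall s\notin I$: $V_0(s)\ge1$.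
   Context: Setting. - $\mathsf P_\mu$ is the law on $S^\omega$ of the time-homogeneous Markov chain $(\Phi_n)$ with initial distribution $\mu$ and kernel $P$. - $\mathrm{Fin}(A)=\bigcup_{n}\bigcap_{m\ge n}\{\Phi_m\notin A\}$ and $\mathrm{Inf}(A)=\bigcap_n\bigcup_{m\ge n}\{\Phi_m\in A\}$. Notation. $PV(s)=\sum_u V(u)P(s,\{u\})$ and $\mu V=\sum_s V(s)\mu(\{s\})$. *)

theory Defs
  imports "HOL-Probability.Probability"
begin

text \<open>
  On a countable state space with the full powerset as sigma-algebra, probability measures are
  exactly pmfs: a Markov chain is an initial distribution \<open>\<mu>\<close> and a kernel \<open>P\<close> with
  \<open>P(s, X) = measure_pmf.prob (P s) X\<close> and \<open>P(s, {u}) = pmf (P s) u\<close>.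
\<close>

definition chain_step :: "'s pmf \<Rightarrow> ('s \<Rightarrow> 's pmf) \<Rightarrow> nat \<Rightarrow> (nat \<Rightarrow> 's) \<Rightarrow> 's measure" where
  "chain_step \<mu> P n \<omega> = measure_pmf (case n of 0 \<Rightarrow> \<mu> | Suc m \<Rightarrow> P (\<omega> m))"

lemma Ionescu_Tulcea_chain_step:
  "Ionescu_Tulcea (chain_step \<mu> P) (\<lambda>_. count_space UNIV)"
proof (rule Ionescu_Tulcea.intro)
  fix i :: nat
  show "chain_step \<mu> P i \<in> measurable (PiM {0..<i} (\<lambda>_. count_space UNIV))
      (subprob_algebra (count_space UNIV))"
  proof (cases i)
    case 0
    then show ?thesis
      by (simp add: chain_step_def[abs_def] measure_pmf_in_subprob_algebra)
  next
    case (Suc m)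
    have "(\<lambda>\<omega>. \<omega> m) \<in> measurable (PiM {0..<i} (\<lambda>_. count_space UNIV)) (count_space UNIV)"
      by (rule measurable_component_singleton) (simp add: Suc)
    then have "(\<lambda>\<omega>. measure_pmf (P (\<omega> m))) \<in> measurable (PiM {0..<i} (\<lambda>_. count_space UNIV))
        (subprob_algebra (count_space UNIV))"
      by (rule measurable_compose) (simp add: measure_pmf_in_subprob_algebra)
    then show ?thesis
      by (simp add: chain_step_def[abs_def] Suc)
  qed
qed (simp add: chain_step_def prob_space_measure_pmf)

text \<open>The law of the chain on \<open>S\<^sup>\<omega>\<close> (product sigma-algebra), by the Ionescu-Tulcea theorem.\<close>

definition chain_law :: "'s pmf \<Rightarrow> ('s \<Rightarrow> 's pmf) \<Rightarrow> (nat \<Rightarrow> 's) measure" where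
  "chain_law \<mu> P = projective_family.lim UNIV
     (Ionescu_Tulcea.CI (chain_step \<mu> P) (\<lambda>_. count_space UNIV)) (\<lambda>_. count_space UNIV)"

lemma sets_chain_law [measurable_cong]:
  "sets (chain_law \<mu> P) = sets (PiM UNIV (\<lambda>_. count_space UNIV))"
proof -
  interpret IT: Ionescu_Tulcea "chain_step \<mu> P" "\<lambda>_. count_space UNIV"
    by (rule Ionescu_Tulcea_chain_step)
  show ?thesis
    unfolding chain_law_def by (rule IT.PF.sets_lim)
qed

lemma space_chain_law [simp]: "space (chain_law \<mu> P) = UNIV"
  using sets_eq_imp_space_eq[OF sets_chain_law[of \<mu> P]] by (simp add: space_PiM)

lemma emeasure_chain_law_cylinder:
  "emeasure (chain_law \<mu> P) {\<omega>. \<forall>i\<le>n. \<omega> i = s i} =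
     ennreal (pmf \<mu> (s 0) * (\<Prod>i<n. pmf (P (s i)) (s (Suc i))))"
proof -
  let ?M = "\<lambda>_::nat. count_space (UNIV :: 'a set)"
  interpret IT: Ionescu_Tulcea "chain_step \<mu> P" ?M
    by (rule Ionescu_Tulcea_chain_step)
  let ?X = "\<lambda>n. (\<Pi>\<^sub>E i\<in>{0..<n}. {s i})"
  let ?C = "\<lambda>n. IT.C 0 n (\<lambda>_. undefined)"
  have X_sets: "?X n \<in> sets (PiM {0..<n} ?M)" for n
    by (rule sets_PiM_I_finite) auto
  have u: "(\<lambda>_. undefined) \<in> space (PiM {0..<0} ?M)"
    by (simp add: space_PiM)
  have step: "emeasure (?C (Suc n)) (?X (Suc n)) =
      emeasure (?C n) (?X n) * emeasure (chain_step \<mu> P n s) {s n}" for n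
  proof -
    have sp: "space (?C n) = space (PiM {0..<n} ?M)"
      using IT.space_C[OF u, of n] by simp
    have st: "sets (?C n) = sets (PiM {0..<n} ?M)"
      using IT.sets_C[OF u, of n] by simp
    have "emeasure (?C (Suc n)) (?X (Suc n)) = (\<integral>\<^sup>+\<omega>. emeasure (IT.eP n \<omega>) (?X (Suc n)) \<partial>?C n)"
      using IT.measurable_eP[of n] X_sets[of "Suc n"]
      by (simp, subst emeasure_bind[where N = "PiM {0..<Suc n} ?M"])
         (auto simp: sp space_PiM measurable_cong_sets[OF st refl] PiE_eq_empty_iff)
    also have "\<dots> = (\<integral>\<^sup>+\<omega>. emeasure (chain_step \<mu> P n s) {s n} * indicator (?X n) \<omega> \<partial>?C n)"
    proof (rule nn_integral_cong)
      fix \<omega> assume w: "\<omega> \<in> space (?C n)"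
      then have w': "\<omega> \<in> space (PiM {0..<n} ?M)" by (simp add: sp)
      have e: "emeasure (IT.eP n \<omega>) (?X (Suc n)) =
          emeasure (chain_step \<mu> P n \<omega>) (fun_upd \<omega> n -` ?X (Suc n))"
        using IT.emeasure_eP[OF w' X_sets[of "Suc n"]] by simp
      show "emeasure (IT.eP n \<omega>) (?X (Suc n)) =
          emeasure (chain_step \<mu> P n s) {s n} * indicator (?X n) \<omega>"
      proof (cases "\<omega> \<in> ?X n")
        case True
        have "chain_step \<mu> P n \<omega> = chain_step \<mu> P n s"
          using True by (cases n) (auto simp: chain_step_def PiE_iff)
        moreover have "fun_upd \<omega> n -` ?X (Suc n) = {s n}"
          using True by (auto simp: PiE_iff extensional_def atLeastLessThanSuc)
        ultimately show ?thesis using True e by simp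
      next
        case False
        have "fun_upd \<omega> n -` ?X (Suc n) = {}"
        proof (rule ccontr)
          assume "fun_upd \<omega> n -` ?X (Suc n) \<noteq> {}"
          then obtain x where x: "fun_upd \<omega> n x \<in> ?X (Suc n)" by auto
          have "\<omega> i = s i" if "i < n" for i
            using x that by (auto simp: PiE_iff dest!: bspec[of _ _ i])
          then have "\<omega> \<in> ?X n"
            using w' by (auto simp: PiE_iff space_PiM)
          with False show False by simp
        qed
        then show ?thesis using False e by simp
      qed
    qed
    also have "\<dots> = emeasure (?C n) (?X n) * emeasure (chain_step \<mu> P n s) {s n}"
      using X_sets[of n] by (subst nn_integral_cmult_indicator) (simp_all add: st mult.commute)
    finally show ?thesis .
  qed
  have C: "emeasure (?C (Suc n)) (?X (Suc n)) =
      ennreal (pmf \<mu> (s 0) * (\<Prod>i<n. pmf (P (s i)) (s (Suc i))))" for n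
  proof (induction n)
    case 0
    show ?case
      unfolding step by (simp add: chain_step_def emeasure_pmf_single sets_PiM_empty)
  next
    case (Suc n)
    show ?case
      unfolding step[of "Suc n"] Suc.IH
      by (simp add: chain_step_def emeasure_pmf_single ennreal_mult'[symmetric] mult.assoc
          prod_nonneg)
  qed
  have "{\<omega>. \<forall>i\<le>n. \<omega> i = s i} = prod_emb UNIV ?M {0..<Suc n} (?X (Suc n))"
    by (auto simp: prod_emb_def PiE_iff less_Suc_eq_le)
  then have "emeasure (chain_law \<mu> P) {\<omega>. \<forall>i\<le>n. \<omega> i = s i} =
      emeasure (IT.CI {0..<Suc n}) (?X (Suc n))"
    unfolding chain_law_def using IT.lim[OF _ X_sets[of "Suc n"]] by simp
  also have "\<dots> = emeasure (?C (Suc n)) (?X (Suc n))"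
    using IT.emeasure_CI[OF subset_refl X_sets[of "Suc n"]] by (simp add: prod_emb_id PiE_iff subset_eq)
  finally show ?thesis
    using C by simp
qed

definition Fin :: "'s set \<Rightarrow> (nat \<Rightarrow> 's) set" where
  "Fin A = (\<Union>n. \<Inter>m\<in>{n..}. {\<omega>. \<omega> m \<notin> A})"

definition Inf_often :: "'s set \<Rightarrow> (nat \<Rightarrow> 's) set" where
  "Inf_often A = (\<Inter>n. \<Union>m\<in>{n..}. {\<omega>. \<omega> m \<in> A})"

text \<open>
  For nonnegative \<open>V\<close>, \<open>wsum (P s) V\<close> is \<open>PV(s)\<close> and \<open>wsum \<mu> V\<close> is \<open>\<mu>V\<close>. The value lies in
  \<open>[0, \<infinity>]\<close>, so that a bound \<open>wsum D V \<le> ennreal c\<close> includes finiteness of the series.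
\<close>

definition wsum :: "'s pmf \<Rightarrow> ('s \<Rightarrow> real) \<Rightarrow> ennreal" where
  "wsum D V = (\<Sum>\<^sub>\<infinity>u. ennreal (V u * pmf D u))"

lemma wsum_eq_nn_integral:
  fixes D :: "'s::countable pmf"
  assumes "\<And>u. 0 \<le> V u"
  shows "wsum D V = (\<integral>\<^sup>+u. ennreal (V u) \<partial>measure_pmf D)"
proof -
  let ?f = "\<lambda>u. ennreal (V u * pmf D u)"
  let ?F = "\<lambda>n. {u :: 's. to_nat u < n}"
  have fin: "finite (?F n)" for n
    using finite_vimageI[OF finite_lessThan[of n] inj_to_nat] by (simp add: vimage_def)
  have S: "wsum D V = (SUP F\<in>{F. finite F}. sum ?f F)"
    unfolding wsum_def by (subst nonneg_infsum_complete) simp_all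
  have part: "(\<integral>\<^sup>+u. ?f u * indicator F u \<partial>count_space UNIV) = sum ?f F" if "finite F" for F
    using that
    by (simp add: nn_integral_count_space_indicator[symmetric] nn_integral_count_space_finite)
  have "(\<integral>\<^sup>+u. ennreal (V u) \<partial>measure_pmf D) = (\<integral>\<^sup>+u. ?f u \<partial>count_space UNIV)"
    by (simp add: nn_integral_measure_pmf ennreal_mult assms mult.commute)
  also have "\<dots> = (\<integral>\<^sup>+u. (SUP n. ?f u * indicator (?F n) u) \<partial>count_space UNIV)"
  proof (rule nn_integral_cong)
    fix u :: 's
    show "?f u = (SUP n. ?f u * indicator (?F n) u)"
      by (rule antisym)
         (auto intro!: SUP_upper2[of "Suc (to_nat u)"] SUP_least split: split_indicator)
  qed
  also have "\<dots> = (SUP n. \<integral>\<^sup>+u. ?f u * indicator (?F n) u \<partial>count_space UNIV)"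
    by (rule nn_integral_monotone_convergence_SUP)
       (auto simp: incseq_def le_fun_def split: split_indicator)
  also have "\<dots> = (SUP n. sum ?f (?F n))"
    using part[OF fin] by simp
  finally have N: "(\<integral>\<^sup>+u. ennreal (V u) \<partial>measure_pmf D) = (SUP n. sum ?f (?F n))" .
  have N': "(\<integral>\<^sup>+u. ennreal (V u) \<partial>measure_pmf D) = (\<integral>\<^sup>+u. ?f u \<partial>count_space UNIV)"
    by (simp add: nn_integral_measure_pmf ennreal_mult assms mult.commute)
  show ?thesis
  proof (rule antisym)
    show "wsum D V \<le> (\<integral>\<^sup>+u. ennreal (V u) \<partial>measure_pmf D)"
      unfolding S
    proof (rule SUP_least)
      fix F :: "'s set" assume "F \<in> {F. finite F}"
      then have "sum ?f F = (\<integral>\<^sup>+u. ?f u * indicator F u \<partial>count_space UNIV)"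
        using part by simp
      also have "\<dots> \<le> (\<integral>\<^sup>+u. ?f u \<partial>count_space UNIV)"
        by (rule nn_integral_mono) (simp split: split_indicator)
      finally show "sum ?f F \<le> (\<integral>\<^sup>+u. ennreal (V u) \<partial>measure_pmf D)"
        unfolding N' .
    qed
    show "(\<integral>\<^sup>+u. ennreal (V u) \<partial>measure_pmf D) \<le> wsum D V"
      unfolding N S using fin by (intro SUP_least SUP_upper) simp
  qed
qed

end

theory Submission
  imports Defs
begin

text \<open>
  Let \<open>g s\<close> be the probability that the chain from \<open>s\<close> violates the Streett condition. Then \<open>g\<close>
  is harmonic, \<open>I = {s. g s < 1 - \<delta>}\<close> and \<open>V0 = g / (1 - \<delta>)\<close> for small \<open>\<delta>\<close>. For a pair \<open>(A, B)\<close>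
  let \<open>V s\<close> be the probability of reaching \<open>A\<close> from \<open>s\<close>, and \<open>J = {s \<in> I. V s \<le> 1/2}\<close>.

  The set \<open>T = B \<union> J \<union> - I\<close> is hit almost surely. Otherwise the probability of avoiding \<open>T\<close>
  forever is arbitrarily close to 1 at some states, so it is compatible with acceptance, and
  acceptance without \<open>B\<close> means that eventually \<open>A\<close> is avoided. So the probability of avoiding both
  \<open>T\<close> and \<open>A\<close> is positive somewhere, hence above \<open>1/2\<close> at some state outside \<open>T\<close>, where
  nevertheless \<open>V > 1/2\<close>.

  Since \<open>T\<close> is hit almost surely, the probability of meeting a state of index \<open>\<ge> n\<close> before \<open>T\<close>
  tends to 0 as \<open>n\<close> grows, so these probabilities are summable along a subsequence. Their sum is a
  supermartingale off \<open>T\<close> with finite sublevel sets. Adding \<open>\<Sum>n. 2\<^sup>-\<^sup>n * Pr(T not hit by time n)\<close>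
  makes the drift strict, so every state outside \<open>T\<close> has a successor of smaller value, and \<open>d\<close>
  and the success probabilities are minima over the finite sublevel sets.
\<close>

section \<open>Path space and cylinder sets\<close>

abbreviation path_space :: "(nat \<Rightarrow> 's) measure" where
  "path_space \<equiv> PiM UNIV (\<lambda>_. count_space UNIV)"

text \<open>Countability of the state space makes every one-coordinate event a countable union of
  cylinders, one per finite prefix. The empty set joins the generator because incompatible cylinders
  are disjoint, and the family has to be closed under intersection.\<close>

lemma sets_path_space_eq_sigma_cylinders:
  "sets (path_space :: (nat \<Rightarrow> 's::countable) measure) =
    sigma_sets UNIV (insert {} {{\<omega>. \<forall>i\<le>n. \<omega> i = t i} | n t. True})"
    (is "_ = sigma_sets UNIV ?E")
proof
  have "{\<omega>::nat \<Rightarrow> 's. \<omega> i \<in> X} \<in> sigma_sets UNIV ?E" for i X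
  proof -
    have "{\<omega>. \<omega> i \<in> X} =
        (\<Union>l\<in>{l :: 's list. length l = Suc i \<and> l ! i \<in> X}. {\<omega>. \<forall>j\<le>i. \<omega> j = l ! j})"
    proof (intro set_eqI iffI)
      fix \<omega> assume w: "\<omega> \<in> {\<omega>. \<omega> i \<in> X}"
      show "\<omega> \<in> (\<Union>l\<in>{l. length l = Suc i \<and> l ! i \<in> X}. {\<omega>. \<forall>j\<le>i. \<omega> j = l ! j})"
        by (rule UN_I[where a = "map \<omega> [0..<Suc i]"])
           (use w in \<open>auto simp del: upt_Suc simp: less_Suc_eq_le\<close>)
    qed auto
    also have "\<dots> \<in> sigma_sets UNIV ?E"
    proof -
      interpret sigma_algebra UNIV "sigma_sets UNIV ?E"
        by (rule sigma_algebra_sigma_sets) auto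
      show ?thesis
        by (rule countable_UN') (auto intro!: sigma_sets.Basic)
    qed
    finally show ?thesis .
  qed
  then have "{{f \<in> UNIV \<rightarrow>\<^sub>E space (count_space (UNIV :: 's set)). f i \<in> X} | i X.
      i \<in> UNIV \<and> X \<in> sets (count_space UNIV)} \<subseteq> sigma_sets UNIV ?E"
    by auto
  moreover have "UNIV \<rightarrow>\<^sub>E space (count_space (UNIV :: 's set)) = (UNIV :: (nat \<Rightarrow> 's) set)"
    by auto
  ultimately show "sets (path_space :: (nat \<Rightarrow> 's) measure) \<subseteq> sigma_sets UNIV ?E"
    unfolding sets_PiM_single by (metis (no_types, lifting) sigma_sets_mono)
next
  have "{\<omega>::nat \<Rightarrow> 's. \<forall>i\<le>n. \<omega> i = t i} \<in> sets path_space" for n t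
  proof -
    have "{\<omega> \<in> space path_space. \<forall>i\<le>n. \<omega> i = t i} \<in> sets path_space"
      by measurable
    then show ?thesis by (simp add: space_PiM)
  qed
  moreover have "sigma_sets (space path_space) ?E \<subseteq> sets (path_space :: (nat \<Rightarrow> 's) measure)"
    if "?E \<subseteq> sets path_space"
    using that by (rule sets.sigma_sets_subset)
  ultimately show "sigma_sets UNIV ?E \<subseteq> sets (path_space :: (nat \<Rightarrow> 's) measure)"
    by (auto simp: space_PiM)
qed

text \<open>Two cylinders are either nested or disjoint, so Dynkin's uniqueness theorem applies.
  This turns the explicit cylinder formula for \<open>chain_law\<close> into identities between
  measures.\<close>

lemma path_measure_eqI:
  fixes M N :: "(nat \<Rightarrow> 's::countable) measure"
  assumes "sets M = sets path_space" "sets N = sets path_space" "finite_measure M"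
    and eq: "\<And>n t. emeasure M {\<omega>. \<forall>i\<le>n. \<omega> i = t i} = emeasure N {\<omega>. \<forall>i\<le>n. \<omega> i = t i}"
  shows "M = N"
proof (rule measure_eqI_generator_eq_countable)
  let ?E = "insert {} {{\<omega>::nat \<Rightarrow> 's. \<forall>i\<le>n. \<omega> i = t i} | n t. True}"
  show "Int_stable ?E"
  proof -
    have Int_le: "{\<omega>. \<forall>i\<le>n. \<omega> i = t i} \<inter> {\<omega>. \<forall>i\<le>m. \<omega> i = u i} \<in> ?E"
      if "n \<le> m" for n m and t u :: "nat \<Rightarrow> 's"
    proof (cases "\<forall>i\<le>n. t i = u i")
      case True
      then have "{\<omega>. \<forall>i\<le>n. \<omega> i = t i} \<inter> {\<omega>. \<forall>i\<le>m. \<omega> i = u i} = {\<omega>. \<forall>i\<le>m. \<omega> i = u i}"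
        using that by auto
      then show ?thesis by blast
    next
      case False
      then have "{\<omega>. \<forall>i\<le>n. \<omega> i = t i} \<inter> {\<omega>. \<forall>i\<le>m. \<omega> i = u i} = {}"
        using that by force
      then show ?thesis by blast
    qed
    have *: "{\<omega>. \<forall>i\<le>n. \<omega> i = t i} \<inter> {\<omega>. \<forall>i\<le>m. \<omega> i = u i} \<in> ?E"
      for n m and t u :: "nat \<Rightarrow> 's"
    proof (cases "n \<le> m")
      case False
      then show ?thesis
        using Int_le[of m n u t] by (simp add: Int_commute)
    qed (rule Int_le)
    show ?thesis
    proof (rule Int_stableI)
      fix a b assume ab: "a \<in> ?E" "b \<in> ?E"
      show "a \<inter> b \<in> ?E"
      proof (cases "a = {} \<or> b = {}")
        case False
        with ab obtain n t m u where
          "a = {\<omega>. \<forall>i\<le>n. \<omega> i = t i}" "b = {\<omega>. \<forall>i\<le>m. \<omega> i = u i}" by blast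
        then show ?thesis using * by simp
      qed auto
    qed
  qed
  \<comment> \<open>The cylinders that fix only the initial state form the required countable
    cover.\<close>
  show "range (\<lambda>s. {\<omega>::nat \<Rightarrow> 's. \<forall>i\<le>0. \<omega> i = s}) \<subseteq> ?E"
    by blast
  show "sets M = sigma_sets UNIV ?E" "sets N = sigma_sets UNIV ?E"
    using assms(1,2) sets_path_space_eq_sigma_cylinders by simp_all
  show "emeasure M X = emeasure N X" if "X \<in> ?E" for X
    using that eq by auto
  show "emeasure M X \<noteq> \<infinity>" for X
    using assms(3) by (simp add: finite_measure.emeasure_eq_measure)
qed auto

text \<open>Projection onto the empty set of coordinates keeps the total mass, and the resulting
  marginal belongs to a projective family of probability measures.\<close>

lemma prob_space_chain_law: "prob_space (chain_law \<mu> P)"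
proof -
  interpret IT: Ionescu_Tulcea "chain_step \<mu> P" "\<lambda>_. count_space UNIV"
    by (rule Ionescu_Tulcea_chain_step)
  have "(\<lambda>\<omega>. restrict \<omega> {}) \<in> measurable IT.PF.lim (PiM {} (\<lambda>_. count_space UNIV))"
    by (simp add: measurable_cong_sets[OF IT.PF.sets_lim refl] measurable_restrict)
  then show ?thesis
    unfolding chain_law_def
    by (rule prob_space_distrD) (simp add: IT.distr_lim IT.PF.prob_space_P)
qed

lemma chain_law_in_subprob_algebra: "chain_law \<mu> P \<in> space (subprob_algebra path_space)"
  by (simp add: space_subprob_algebra sets_chain_law prob_space_chain_law
      prob_space_imp_subprob_space)

lemma emeasure_bind_pmf_path:
  fixes D :: "'s pmf"
  assumes "\<And>u. K u \<in> space (subprob_algebra path_space)" "X \<in> sets path_space"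
  shows "emeasure (measure_pmf D \<bind> K) X = (\<integral>\<^sup>+u. emeasure (K u) X \<partial>D)"
  using assms by (intro emeasure_bind[where N = path_space]) auto

section \<open>Conditioning on the initial state and on the first step\<close>

context
  fixes P :: "'s::countable \<Rightarrow> 's pmf"
begin

abbreviation chain_from :: "'s \<Rightarrow> (nat \<Rightarrow> 's) measure" where
  "chain_from s \<equiv> chain_law (return_pmf s) P"

interpretation chain: prob_space "chain_from s" for s
  by (rule prob_space_chain_law)

lemma cylinder_in_sets: "{\<omega>::nat \<Rightarrow> 's. \<forall>i\<le>n. \<omega> i = t i} \<in> sets path_space"
  unfolding sets_path_space_eq_sigma_cylinders by (rule sigma_sets.Basic) blast

text \<open>On a cylinder the integrand vanishes except at the prescribed initial state, so both
  sides reduce to the same product of transition probabilities.\<close>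

lemma emeasure_chain_law_initial:
  assumes X: "X \<in> sets path_space"
  shows "emeasure (chain_law \<mu> P) X = (\<integral>\<^sup>+s. emeasure (chain_from s) X \<partial>\<mu>)"
proof -
  have "chain_law \<mu> P = measure_pmf \<mu> \<bind> chain_from"
  proof (rule path_measure_eqI)
    fix n and t :: "nat \<Rightarrow> 's"
    have "emeasure (measure_pmf \<mu> \<bind> chain_from) {\<omega>. \<forall>i\<le>n. \<omega> i = t i} =
        (\<integral>\<^sup>+s. ennreal (\<Prod>i<n. pmf (P (t i)) (t (Suc i))) * indicator {t 0} s \<partial>\<mu>)"
      by (auto simp: emeasure_bind_pmf_path chain_law_in_subprob_algebra cylinder_in_sets
          emeasure_chain_law_cylinder indicator_def intro!: nn_integral_cong)
    also have "\<dots> = emeasure (chain_law \<mu> P) {\<omega>. \<forall>i\<le>n. \<omega> i = t i}"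
      by (subst nn_integral_cmult_indicator)
         (simp_all add: emeasure_pmf_single emeasure_chain_law_cylinder ennreal_mult' mult.commute)
    finally show "emeasure (chain_law \<mu> P) {\<omega>. \<forall>i\<le>n. \<omega> i = t i} =
        emeasure (measure_pmf \<mu> \<bind> chain_from) {\<omega>. \<forall>i\<le>n. \<omega> i = t i}" ..
  next
    show "sets (measure_pmf \<mu> \<bind> chain_from) = sets path_space"
      by (rule sets_bind) (auto simp: sets_chain_law)
    show "finite_measure (chain_law \<mu> P)"
      using prob_space_chain_law by (rule prob_space.finite_measure)
  qed (simp add: sets_chain_law)
  then show ?thesis
    using emeasure_bind_pmf_path[OF chain_law_in_subprob_algebra X] by simp
qed

lemma case_nat_measurable [measurable]:
  "case_nat s \<in> measurable path_space (path_space :: (nat \<Rightarrow> 's) measure)"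
  by (rule measurable_PiM_single') (auto simp: space_PiM split: nat.split)

text \<open>This is the Markov property at time 1, with \<open>case_nat s\<close> prepending the
  starting state. Stated for preimages of arbitrary events, it yields every later recursion and
  superharmonicity claim from a set identity or inclusion.\<close>

lemma emeasure_chain_from_step:
  assumes X: "X \<in> sets path_space"
  shows "emeasure (chain_from s) X = (\<integral>\<^sup>+u. emeasure (chain_from u) (case_nat s -` X) \<partial>P s)"
proof -
  let ?K = "\<lambda>u. distr (chain_from u) path_space (case_nat s)"
  have K: "?K u \<in> space (subprob_algebra path_space)" for u
    by (simp add: space_subprob_algebra prob_space_imp_subprob_space chain.prob_space_distr)
  have em: "emeasure (?K u) Y = emeasure (chain_from u) (case_nat s -` Y)"
    if "Y \<in> sets path_space" for u Y
    using that by (subst emeasure_distr) simp_all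
  have "chain_from s = measure_pmf (P s) \<bind> ?K"
  proof (rule path_measure_eqI)
    fix n and t :: "nat \<Rightarrow> 's"
    have v: "case_nat s -` {\<omega>. \<forall>i\<le>n. \<omega> i = t i} =
        (if s \<noteq> t 0 then {} else if n = 0 then UNIV else {\<omega>. \<forall>i\<le>n - 1. \<omega> i = t (Suc i)})"
    proof (cases n)
      case (Suc m)
      then show ?thesis
        using All_less_Suc2[of "Suc m" "\<lambda>i. case_nat s \<omega> i = t i" for \<omega>]
        by (auto simp: less_Suc_eq_le)
    qed auto
    have "emeasure (measure_pmf (P s) \<bind> ?K) {\<omega>. \<forall>i\<le>n. \<omega> i = t i} =
        (\<integral>\<^sup>+u. emeasure (chain_from u) (case_nat s -` {\<omega>. \<forall>i\<le>n. \<omega> i = t i}) \<partial>P s)"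
      by (simp add: emeasure_bind_pmf_path K em cylinder_in_sets)
    also have "\<dots> = emeasure (chain_law (return_pmf s) P) {\<omega>. \<forall>i\<le>n. \<omega> i = t i}"
    proof (cases "s = t 0 \<and> n \<noteq> 0")
      case True
      then obtain m where m: "n = Suc m" by (cases n) auto
      \<comment> \<open>Averaging \<open>chain_from u\<close> over the successor \<open>u\<close>
        gives the chain with initial distribution \<open>P s\<close>, so the cylinder formula
        applies to the shifted cylinder.\<close>
      have "(\<integral>\<^sup>+u. emeasure (chain_from u) (case_nat s -` {\<omega>. \<forall>i\<le>n. \<omega> i = t i}) \<partial>P s) =
        emeasure (chain_law (P s) P) {\<omega>. \<forall>i\<le>m. \<omega> i = t (Suc i)}"
        using True m v emeasure_chain_law_initial[OF cylinder_in_sets, where \<mu> = "P s"] by simp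
      then show ?thesis using True m
        by (simp add: emeasure_chain_law_cylinder prod.lessThan_Suc_shift del: prod.lessThan_Suc)
    next
      case False
      then show ?thesis
        using chain.emeasure_space_1 unfolding v
        by (auto simp: emeasure_chain_law_cylinder)
    qed
    finally show "emeasure (chain_from s) {\<omega>. \<forall>i\<le>n. \<omega> i = t i} =
      emeasure (measure_pmf (P s) \<bind> ?K) {\<omega>. \<forall>i\<le>n. \<omega> i = t i}" ..
  next
    show "sets (measure_pmf (P s) \<bind> ?K) = sets path_space"
      by (rule sets_bind) auto
    show "finite_measure (chain_from s)"
      by (rule chain.finite_measure)
  qed (simp add: sets_chain_law)
  then show ?thesis
    using emeasure_bind_pmf_path[OF K X] em[OF X] by simp
qed

lemma path_event_in_sets: "Measurable.pred path_space Q \<Longrightarrow> {\<omega>. Q \<omega>} \<in> sets path_space"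
  by (simp add: pred_def space_PiM)

section \<open>Probabilities of remaining in a set\<close>

definition stay :: "'s set \<Rightarrow> (nat \<Rightarrow> 's) set" where
  "stay C = {\<omega>. \<forall>n. \<omega> n \<in> C}"

definition stay_upto :: "nat \<Rightarrow> 's set \<Rightarrow> (nat \<Rightarrow> 's) set" where
  "stay_upto n C = {\<omega>. \<forall>i<n. \<omega> i \<in> C}"

lemma stay_in_sets [measurable]:
  "stay C \<in> sets path_space" "stay_upto n C \<in> sets path_space"
  unfolding stay_def stay_upto_def by (rule path_event_in_sets, measurable)+

lemma All_nat_iff: "(\<forall>n. Q n) \<longleftrightarrow> Q 0 \<and> (\<forall>n. Q (Suc n))"
  by (metis not0_implies_Suc)

lemma vimage_case_nat_stay:
  "case_nat s -` stay C = (if s \<in> C then stay C else {})"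
  "case_nat s -` stay_upto (Suc n) C = (if s \<in> C then stay_upto n C else {})"
  by (auto simp: stay_def stay_upto_def vimage_def All_less_Suc2 All_nat_iff[of "\<lambda>n. case_nat _ _ n \<in> _"])

lemma emeasure_stay:
  "emeasure (chain_from s) (stay C) =
    (if s \<in> C then \<integral>\<^sup>+u. emeasure (chain_from u) (stay C) \<partial>P s else 0)"
  by (subst emeasure_chain_from_step) (simp_all add: vimage_case_nat_stay stay_in_sets)

lemma emeasure_stay_upto_Suc:
  "emeasure (chain_from s) (stay_upto (Suc n) C) =
    (if s \<in> C then \<integral>\<^sup>+u. emeasure (chain_from u) (stay_upto n C) \<partial>P s else 0)"
  by (subst emeasure_chain_from_step) (simp_all add: vimage_case_nat_stay stay_in_sets)

lemma stay_upto_tendsto: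
  "(\<lambda>n. emeasure (chain_from s) (stay_upto n C)) \<longlonglongrightarrow> emeasure (chain_from s) (stay C)"
proof -
  have "(\<Inter>n. stay_upto n C) = stay C"
    by (auto simp: stay_def stay_upto_def)
  moreover have "(\<lambda>n. emeasure (chain_from s) (stay_upto n C)) \<longlonglongrightarrow>
      emeasure (chain_from s) (\<Inter>n. stay_upto n C)"
  proof (rule Lim_emeasure_decseq)
    show "decseq (\<lambda>n. stay_upto n C)"
      by (auto simp: decseq_def stay_upto_def)
  qed (auto simp: sets_chain_law stay_in_sets chain.emeasure_finite)
  ultimately show ?thesis by simp
qed

text \<open>
  If \<open>c\<close> bounds \<open>v = emeasure (chain_from _) (stay C)\<close>, then restarting the chain at time \<open>n\<close>
  gives \<open>v \<le> c * emeasure (chain_from _) (stay_upto n C)\<close>, hence \<open>v \<le> c * v\<close> in the limit.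
  This replaces Levy's zero-one law.
\<close>

lemma stay_probability_near_1:
  assumes pos: "emeasure (chain_from s) (stay C) > 0" and c: "c < 1"
  shows "\<exists>u. emeasure (chain_from u) (stay C) > ennreal c"
proof (rule ccontr)
  assume "\<not> ?thesis"
  then have le: "emeasure (chain_from u) (stay C) \<le> ennreal c" for u
    by (simp add: not_less)
  have "emeasure (chain_from u) (stay C) \<le> ennreal c * emeasure (chain_from u) (stay_upto n C)" for u n
  proof (induction n arbitrary: u)
    case 0
    show ?case
      using le chain.emeasure_space_1 by (simp add: stay_upto_def)
  next
    case (Suc n)
    have "(\<integral>\<^sup>+v. emeasure (chain_from v) (stay C) \<partial>P u) \<le>
        (\<integral>\<^sup>+v. ennreal c * emeasure (chain_from v) (stay_upto n C) \<partial>P u)"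
      by (intro nn_integral_mono Suc.IH)
    also have "\<dots> = ennreal c * (\<integral>\<^sup>+v. emeasure (chain_from v) (stay_upto n C) \<partial>P u)"
      by (simp add: nn_integral_cmult)
    finally show ?case
      by (simp add: emeasure_stay[of u] emeasure_stay_upto_Suc)
  qed
  then have "emeasure (chain_from s) (stay C) \<le> ennreal c * emeasure (chain_from s) (stay C)"
    by (intro tendsto_lowerbound[OF ennreal_tendsto_cmult[OF _ stay_upto_tendsto]]) auto
  moreover have "ennreal c * emeasure (chain_from s) (stay C) < emeasure (chain_from s) (stay C)"
  proof -
    have "ennreal c * emeasure (chain_from s) (stay C) < 1 * emeasure (chain_from s) (stay C)"
      using pos c by (intro ennreal_mult_strict_right_mono) (auto simp: ennreal_less_one_iff less_top[symmetric])
    then show ?thesis by simp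
  qed
  ultimately show False by simp
qed

text \<open>One step of the chain lowers the time bound by one, so the induction needs the
  hypothesis at every starting state.\<close>

lemma eventually_stay_null:
  assumes "\<And>u. emeasure (chain_from u) (stay D) = 0"
  shows "emeasure (chain_from s) {\<omega>. \<forall>m\<ge>n. \<omega> m \<in> D} = 0"
proof (induction n arbitrary: s)
  case 0
  show ?case using assms by (simp add: stay_def)
next
  case (Suc n)
  have "case_nat s -` {\<omega>. \<forall>m\<ge>Suc n. \<omega> m \<in> D} = {\<omega>. \<forall>m\<ge>n. \<omega> m \<in> D}"
    by (auto simp: Suc_le_eq All_nat_iff[of "\<lambda>m. _ < m \<longrightarrow> _ m"] less_Suc_eq_le)
  moreover have "{\<omega>. \<forall>m\<ge>Suc n. \<omega> m \<in> D} \<in> sets path_space"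
    by (rule path_event_in_sets) measurable
  ultimately show ?case
    by (subst emeasure_chain_from_step) (simp_all add: Suc.IH)
qed

section \<open>Almost sure hitting from the acceptance condition\<close>

lemma Fin_Inf_often_in_sets [measurable]:
  "Fin X \<in> sets (path_space :: (nat \<Rightarrow> 's) measure)"
  "Inf_often X \<in> sets (path_space :: (nat \<Rightarrow> 's) measure)"
proof -
  have "Fin X = {\<omega>. \<exists>n. \<forall>m\<ge>n. \<omega> m \<notin> X}" "Inf_often X = {\<omega>. \<forall>n. \<exists>m\<ge>n. \<omega> m \<in> X}"
    by (auto simp: Fin_def Inf_often_def)
  moreover have "{\<omega>. \<exists>n. \<forall>m\<ge>n. \<omega> m \<notin> X} \<in> sets (path_space :: (nat \<Rightarrow> 's) measure)"
      "{\<omega>. \<forall>n. \<exists>m\<ge>n. \<omega> m \<in> X} \<in> sets (path_space :: (nat \<Rightarrow> 's) measure)"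
    by (rule path_event_in_sets, measurable)+
  ultimately show "Fin X \<in> sets (path_space :: (nat \<Rightarrow> 's) measure)"
      "Inf_often X \<in> sets (path_space :: (nat \<Rightarrow> 's) measure)"
    by simp_all
qed

lemma reach_in_sets [measurable]: "{\<omega>. \<exists>n. \<omega> n \<in> X} \<in> sets (path_space :: (nat \<Rightarrow> 's) measure)"
  by (rule path_event_in_sets) measurable

text \<open>Here \<open>C\<close> stands for the complement of the target set. The near-1 principle
  is applied twice: at level \<open>c\<close>, to beat the rejection probability, and at level 1/2,
  to contradict the lower bound on reaching \<open>X\<close>.\<close>

lemma stay_null_of_acceptance:
  assumes meas: "Acc \<in> sets path_space" and Acc: "Acc \<subseteq> Fin X \<union> Inf_often Y"
    and c: "c < 1"
    and C: "\<And>s. s \<in> C \<Longrightarrow> s \<notin> Y"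
      "\<And>s. s \<in> C \<Longrightarrow> measure (chain_from s) (- Acc) < c"
      "\<And>s. s \<in> C \<Longrightarrow> 1/2 < measure (chain_from s) {\<omega>. \<exists>n. \<omega> n \<in> X}"
  shows "emeasure (chain_from s) (stay C) = 0"
proof (rule ccontr)
  assume "emeasure (chain_from s) (stay C) \<noteq> 0"
  then obtain s' where s': "emeasure (chain_from s') (stay C) > ennreal c"
    using stay_probability_near_1[OF _ c] by (auto simp: zero_less_iff_neq_zero)
  then have "s' \<in> C"
    by (subst (asm) emeasure_stay) (auto split: if_splits)
  have c0: "0 \<le> c"
    using C(2)[OF \<open>s' \<in> C\<close>] by (meson less_eq_real_def measure_nonneg order_le_less_trans)
  have nAcc: "- Acc \<in> sets path_space"
    using sets.compl_sets[OF meas] by (simp add: space_PiM Compl_eq_Diff_UNIV)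
  have "\<exists>u. emeasure (chain_from u) (stay (C - X)) > 0"
  proof (rule ccontr)
    assume "\<not> ?thesis"
    then have null: "emeasure (chain_from s') {\<omega>. \<forall>m\<ge>n. \<omega> m \<in> C - X} = 0" for n
      by (intro eventually_stay_null) (simp add: zero_less_iff_neq_zero)
    have ev: "{\<omega>. \<forall>m\<ge>n. \<omega> m \<in> C - X} \<in> sets path_space" for n
      by (rule path_event_in_sets) measurable
    have null': "emeasure (chain_from s') (\<Union>n. {\<omega>. \<forall>m\<ge>n. \<omega> m \<in> C - X}) = 0"
      using null ev by (intro emeasure_UN_eq_0) (auto simp: sets_chain_law)
    \<comment> \<open>A path staying in \<open>C\<close> never meets \<open>Y\<close>; if it is
      accepted, it visits \<open>X\<close> finitely often and so ends up in
      \<open>C - X\<close>.\<close>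
    have "stay C \<subseteq> - Acc \<union> (\<Union>n. {\<omega>. \<forall>m\<ge>n. \<omega> m \<in> C - X})"
    proof
      fix \<omega> assume w: "\<omega> \<in> stay C"
      show "\<omega> \<in> - Acc \<union> (\<Union>n. {\<omega>. \<forall>m\<ge>n. \<omega> m \<in> C - X})"
      proof (cases "\<omega> \<in> Acc")
        case True
        moreover have "\<omega> \<notin> Inf_often Y"
          using w C(1) by (auto simp: stay_def Inf_often_def)
        ultimately have "\<omega> \<in> Fin X" using Acc by auto
        then show ?thesis using w by (auto simp: stay_def Fin_def)
      qed simp
    qed
    then have "emeasure (chain_from s') (stay C) \<le>
        emeasure (chain_from s') (- Acc \<union> (\<Union>n. {\<omega>. \<forall>m\<ge>n. \<omega> m \<in> C - X}))"
      using ev nAcc by (intro emeasure_mono) (auto simp: sets_chain_law)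
    also have "\<dots> \<le> emeasure (chain_from s') (- Acc) +
        emeasure (chain_from s') (\<Union>n. {\<omega>. \<forall>m\<ge>n. \<omega> m \<in> C - X})"
      using ev nAcc by (intro emeasure_subadditive) (auto simp: sets_chain_law)
    also have "\<dots> < ennreal c"
      using C(2)[OF \<open>s' \<in> C\<close>] c0 unfolding null'
      by (simp add: chain.emeasure_eq_measure ennreal_less_iff)
    finally show False using s' by simp
  qed
  then obtain u where u: "emeasure (chain_from u) (stay (C - X)) > ennreal (1/2)"
    using stay_probability_near_1[of _ _ "1/2"] by auto
  then have "u \<in> C"
    by (subst (asm) emeasure_stay) (auto split: if_splits)
  \<comment> \<open>Staying in \<open>C - X\<close> and reaching \<open>X\<close> are disjoint
    events, yet each has probability above 1/2.\<close>
  have "measure (chain_from u) (stay (C - X) \<union> {\<omega>. \<exists>n. \<omega> n \<in> X}) =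
      measure (chain_from u) (stay (C - X)) + measure (chain_from u) {\<omega>. \<exists>n. \<omega> n \<in> X}"
    by (rule chain.finite_measure_Union) 
       (simp_all add: sets_chain_law stay_in_sets reach_in_sets, auto simp: stay_def)
  moreover have "measure (chain_from u) (stay (C - X)) > 1/2"
    using u unfolding chain.emeasure_eq_measure by (subst (asm) ennreal_less_iff) auto
  ultimately have "measure (chain_from u) (stay (C - X) \<union> {\<omega>. \<exists>n. \<omega> n \<in> X}) > 1"
    using C(3)[OF \<open>u \<in> C\<close>] by simp
  then show False
    using chain.prob_le_1[of u "stay (C - X) \<union> {\<omega>. \<exists>n. \<omega> n \<in> X}"] by simp
qed

section \<open>Lyapunov functions and uniform progress\<close>

text \<open>The function is a sum \<open>F + G\<close>: the excursion series \<open>F\<close>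
  supplies the finite sublevel sets, and the bounded series \<open>G\<close> supplies the strict
  drift.\<close>

lemma Lyapunov_function_exists:
  assumes hit: "\<And>s. emeasure (chain_from s) (stay (- T)) = 0"
  shows "\<exists>W. (\<forall>s. 0 \<le> W s) \<and> (\<forall>s\<in>T. W s = 0) \<and>
    (\<forall>s. s \<notin> T \<longrightarrow> 0 < W s \<and> (\<integral>\<^sup>+u. ennreal (W u) \<partial>P s) < ennreal (W s)) \<and>
    (\<forall>r. finite {s. s \<notin> T \<and> W s \<le> r})"
proof -
  \<comment> \<open>The range of \<open>i\<close> includes \<open>m\<close>, so the state of large
    index must itself lie outside \<open>T\<close>.\<close>
  define H where "H n = {\<omega>::nat \<Rightarrow> 's. \<exists>m. n \<le> to_nat (\<omega> m) \<and> (\<forall>i\<le>m. \<omega> i \<notin> T)}" for n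
  define w where "w n s = emeasure (chain_from s) (H n)" for n s
  have H_sets: "H n \<in> sets path_space" for n
    unfolding H_def by (rule path_event_in_sets) measurable
  have w_step: "w n s = (\<integral>\<^sup>+u. emeasure (chain_from u) (case_nat s -` H n) \<partial>P s)" for n s
    unfolding w_def by (rule emeasure_chain_from_step[OF H_sets])
  have vimage_sets: "case_nat s -` H n \<in> sets path_space" for n s
    using measurable_sets[OF case_nat_measurable H_sets] by (simp add: space_PiM)
  \<comment> \<open>Only an inequality holds: when \<open>s\<close> has index at least
    \<open>n\<close>, prepending it creates a visit that the remaining path may lack.\<close>
  have w_super: "(\<integral>\<^sup>+u. w n u \<partial>P s) \<le> w n s" if "s \<notin> T" for n s
  proof -
    have "H n \<subseteq> case_nat s -` H n"
    proof
      fix \<omega> assume "\<omega> \<in> H n"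
      then obtain m where "n \<le> to_nat (\<omega> m)" "\<forall>i\<le>m. \<omega> i \<notin> T"
        by (auto simp: H_def)
      then show "\<omega> \<in> case_nat s -` H n"
        using that by (auto simp: H_def intro!: exI[of _ "Suc m"] split: nat.split)
    qed
    then show ?thesis
      unfolding w_step[of n s] unfolding w_def
      by (intro nn_integral_mono emeasure_mono) (auto simp: sets_chain_law vimage_sets)
  qed
  have w_T: "w n s = 0" if "s \<in> T" for n s
  proof -
    have "case_nat s -` H n = {}"
      using that by (auto simp: H_def split: nat.splits)
    then show ?thesis by (simp add: w_step)
  qed
  have w_1: "w n s = 1" if "s \<notin> T" "n \<le> to_nat s" for n s
  proof -
    have "case_nat s -` H n = UNIV"
      using that by (auto simp: H_def intro!: exI[of _ 0])
    then show ?thesis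
      using chain.emeasure_space_1 by (simp add: w_step)
  qed
  have w_le_1: "w n s \<le> 1" for n s
    unfolding w_def by (rule chain.measure_le_1)
  have w_tendsto: "(\<lambda>n. w n s) \<longlonglongrightarrow> 0" for s
  proof -
    have "(\<lambda>n. w n s) \<longlonglongrightarrow> emeasure (chain_from s) (\<Inter>n. H n)"
      unfolding w_def
    proof (rule Lim_emeasure_decseq)
      show "decseq H"
        unfolding decseq_def H_def using order_trans by blast
    qed (auto simp: sets_chain_law H_sets chain.emeasure_finite)
    \<comment> \<open>Before hitting \<open>T\<close> at time \<open>k\<close> a path sees finitely
      many states, and the sum of their indices bounds each of them.\<close>
    moreover have "(\<Inter>n. H n) \<subseteq> stay (- T)"
    proof (rule subsetI, rule ccontr)
      fix \<omega> assume w: "\<omega> \<in> (\<Inter>n. H n)" "\<omega> \<notin> stay (- T)"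
      then obtain k where k: "\<omega> k \<in> T" by (auto simp: stay_def)
      define n where "n = Suc (\<Sum>i\<le>k. to_nat (\<omega> i))"
      have "\<omega> \<in> H n" using w by auto
      then obtain m where m: "n \<le> to_nat (\<omega> m)" "\<forall>i\<le>m. \<omega> i \<notin> T"
        by (auto simp: H_def)
      then have "m \<le> k" using k by (meson nat_le_linear)
      then have "to_nat (\<omega> m) \<le> (\<Sum>i\<le>k. to_nat (\<omega> i))"
        by (intro member_le_sum) auto
      then show False using m by (simp add: n_def)
    qed
    then have "emeasure (chain_from s) (\<Inter>n. H n) \<le> emeasure (chain_from s) (stay (- T))"
      by (intro emeasure_mono) (auto simp: sets_chain_law stay_in_sets)
    ultimately show ?thesis using hit by simp
  qed
  \<comment> \<open>Diagonal choice: one \<open>n\<close> serves all of the finitely many states of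
    index at most \<open>j\<close>, so for a fixed state the bound holds for all but finitely many
    \<open>j\<close>.\<close>
  have "\<exists>n. \<forall>s\<in>{s. to_nat s \<le> j}. w n s \<le> ennreal ((1/2)^j)" for j
  proof -
    have "finite {s::'s. to_nat s \<le> j}"
      using finite_vimageI[OF finite_atMost[of j] inj_to_nat] by (simp add: vimage_def)
    moreover have "\<forall>\<^sub>F n in sequentially. w n s \<le> ennreal ((1/2)^j)" for s
    proof -
      have "\<forall>\<^sub>F n in sequentially. w n s < ennreal ((1/2)^j)"
        by (rule order_tendstoD(2)[OF w_tendsto]) simp
      then show ?thesis by eventually_elim simp
    qed
    ultimately have "\<forall>\<^sub>F n in sequentially. \<forall>s\<in>{s. to_nat s \<le> j}. w n s \<le> ennreal ((1/2)^j)"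
      by (intro eventually_ball_finite) auto
    then show ?thesis
      using eventually_happens trivial_limit_sequentially by blast
  qed
  then obtain N where N: "\<And>j s. to_nat s \<le> j \<Longrightarrow> w (N j) s \<le> ennreal ((1/2)^j)"
    by (metis mem_Collect_eq)
  define F where "F s = (\<Sum>j. w (N j) s)" for s
  have F_finite: "F s < \<top>" for s
  proof -
    \<comment> \<open>The factor \<open>2 ^ to_nat s\<close> lets a single geometric series also
      cover the small \<open>j\<close>, where only the trivial bound 1 is available.\<close>
    have "w (N j) s \<le> ennreal (2 ^ to_nat s * (1/2)^j)" for j
    proof (cases "to_nat s \<le> j")
      case True
      have "(1/2)^j \<le> 2 ^ to_nat s * (1/2::real)^j" by simp
      then show ?thesis
        using N[OF True] by (meson ennreal_leI order_trans)
    next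
      case False
      then have "(2::real) ^ j \<le> 2 ^ to_nat s" by simp
      then have "1 \<le> 2 ^ to_nat s * (1/2::real)^j"
        by (simp add: power_one_over field_simps)
      then show ?thesis
        using w_le_1[of "N j" s] by (metis ennreal_1 ennreal_leI order_trans)
    qed
    then have "F s \<le> (\<Sum>j. ennreal (2 ^ to_nat s * (1/2)^j))"
      unfolding F_def by (intro suminf_le) auto
    also have "\<dots> = ennreal (\<Sum>j. 2 ^ to_nat s * (1/2)^j)"
      by (intro suminf_ennreal2 summable_mult summable_geometric) auto
    also have "\<dots> < \<top>" by simp
    finally show ?thesis .
  qed
  have F_super: "(\<integral>\<^sup>+u. F u \<partial>P s) \<le> F s" if "s \<notin> T" for s
    unfolding F_def using w_super[OF that]
    by (subst nn_integral_suminf) (auto intro!: suminf_le)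
  have F_ge: "ennreal (real K) \<le> F s" if "s \<notin> T" "\<And>j. j < K \<Longrightarrow> N j \<le> to_nat s" for s K
  proof -
    have "ennreal (real K) = (\<Sum>j<K. w (N j) s)"
      using that by (simp add: w_1 ennreal_of_nat_eq_real_of_nat)
    also have "\<dots> \<le> F s"
      unfolding F_def by (intro sum_le_suminf) auto
    finally show ?thesis .
  qed
  \<comment> \<open>With \<open>Suc n\<close> the times 0 to \<open>n\<close> are inspected, so
    \<open>v 0\<close> is the indicator of the complement of \<open>T\<close>.\<close>
  define v where "v n s = measure (chain_from s) (stay_upto (Suc n) (- T))" for n s
  \<comment> \<open>A step from outside \<open>T\<close> replaces \<open>v n\<close> by
    \<open>v (Suc n)\<close>; the weights only serve convergence.\<close>
  define G where "G s = (\<Sum>n. (1/2)^n * v n s)" for s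
  have v_nonneg: "0 \<le> v n s" and v_le_1: "v n s \<le> 1" for n s
    by (simp_all add: v_def)
  have v_step: "(\<integral>\<^sup>+u. ennreal (v n u) \<partial>P s) = ennreal (v (Suc n) s)" if "s \<notin> T" for n s
    using emeasure_stay_upto_Suc[of s "Suc n" "- T"] that
    by (simp add: v_def chain.emeasure_eq_measure)
  have v_T: "v n s = 0" if "s \<in> T" for n s
    using emeasure_stay_upto_Suc[of s n "- T"] that
    by (simp add: v_def chain.emeasure_eq_measure)
  have v_0: "v 0 s = 1" if "s \<notin> T" for s
    using emeasure_stay_upto_Suc[of s 0 "- T"] that chain.emeasure_space_1
    by (simp add: v_def stay_upto_def[of 0] chain.emeasure_eq_measure)
  have v_Suc: "v (Suc n) s \<le> v n s" for n s
    unfolding v_def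
  proof (rule chain.finite_measure_mono)
    show "stay_upto (Suc (Suc n)) (- T) \<subseteq> stay_upto (Suc n) (- T)"
      by (auto simp: stay_upto_def)
  qed (simp add: sets_chain_law stay_in_sets)
  have v_tendsto: "(\<lambda>n. v n s) \<longlonglongrightarrow> 0" for s
    using LIMSEQ_Suc[OF stay_upto_tendsto[of s "- T"]] hit
    by (simp add: v_def chain.emeasure_eq_measure)
  have summ: "summable (\<lambda>n. (1/2)^n * v (n + i) s)" for i s
    by (rule summable_comparison_test'[where g = "\<lambda>n. (1/2)^n" and N = 0])
       (auto simp: v_nonneg v_le_1 intro!: summable_geometric mult_left_le)
  have G_nonneg: "0 \<le> G s" for s
    unfolding G_def using summ[of 0 s] v_nonneg by (intro suminf_nonneg) auto
  have ennreal_G: "ennreal (G s) = (\<Sum>n. ennreal ((1/2)^n * v n s))" for s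
    unfolding G_def using summ[of 0 s] v_nonneg by (intro suminf_ennreal2[symmetric]) auto
  have G_super: "(\<integral>\<^sup>+u. ennreal (G u) \<partial>P s) < ennreal (G s)" if "s \<notin> T" for s
  proof -
    have "(\<integral>\<^sup>+u. ennreal (G u) \<partial>P s) = (\<Sum>n. \<integral>\<^sup>+u. ennreal ((1/2)^n * v n u) \<partial>P s)"
      unfolding ennreal_G by (rule nn_integral_suminf) simp
    also have "\<dots> = (\<Sum>n. ennreal ((1/2)^n * v (Suc n) s))"
      using v_step[OF that] v_nonneg
      by (simp add: ennreal_mult nn_integral_cmult)
    also have "\<dots> = ennreal (\<Sum>n. (1/2)^n * v (Suc n) s)"
      using summ[of 1 s] v_nonneg by (intro suminf_ennreal2) auto
    also have "\<dots> < ennreal (G s)"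
    proof -
      \<comment> \<open>The sequence starts at 1 and tends to 0, so it drops strictly somewhere, and
        one drop makes the whole series drop.\<close>
      have "\<exists>i. v (Suc i) s < v i s"
      proof (rule ccontr)
        assume "\<not> ?thesis"
        then have "v (Suc n) s = v n s" for n
          using v_Suc[of n s] by (simp add: not_less antisym)
        then have "v n s = 1" for n
          using v_0[OF that] by (induction n) simp_all
        then show False
          using v_tendsto[of s] by (simp add: LIMSEQ_const_iff)
      qed
      then obtain i where i: "v (Suc i) s < v i s" ..
      have "0 < (\<Sum>n. (1/2)^n * v n s - (1/2)^n * v (Suc n) s)"
      proof (rule suminf_pos2)
        show "summable (\<lambda>n. (1/2)^n * v n s - (1/2)^n * v (Suc n) s)"
          using summable_diff[OF summ[of 0 s] summ[of 1 s]] by simp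
        show "0 \<le> (1/2)^n * v n s - (1/2)^n * v (Suc n) s" for n
          using v_Suc by simp
        show "0 < (1/2)^i * v i s - (1/2)^i * v (Suc i) s"
          using i by simp
      qed
      also have "\<dots> = G s - (\<Sum>n. (1/2)^n * v (Suc n) s)"
        unfolding G_def using suminf_diff[OF summ[of 0 s] summ[of 1 s]] by simp
      finally have "(\<Sum>n. (1/2)^n * v (Suc n) s) < G s" by simp
      moreover have "0 \<le> (\<Sum>n. (1/2)^n * v (Suc n) s)"
        using summ[of 1 s] v_nonneg by (intro suminf_nonneg) auto
      ultimately show ?thesis by (simp add: ennreal_less_iff)
    qed
    finally show ?thesis .
  qed
  define W where "W s = enn2real (F s) + G s" for s
  have W_eq: "ennreal (W s) = F s + ennreal (G s)" for s
    using F_finite[of s] G_nonneg by (simp add: W_def)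
  have W_nonneg: "0 \<le> W s" for s
    using G_nonneg by (simp add: W_def)
  have W_super: "(\<integral>\<^sup>+u. ennreal (W u) \<partial>P s) < ennreal (W s)" if "s \<notin> T" for s
  proof -
    have "(\<integral>\<^sup>+u. ennreal (W u) \<partial>P s) = (\<integral>\<^sup>+u. F u \<partial>P s) + (\<integral>\<^sup>+u. ennreal (G u) \<partial>P s)"
      unfolding W_eq by (rule nn_integral_add) auto
    also have "\<dots> \<le> F s + (\<integral>\<^sup>+u. ennreal (G u) \<partial>P s)"
      using F_super[OF that] by (rule add_right_mono)
    also have "\<dots> < ennreal (W s)"
      unfolding W_eq using G_super[OF that] F_finite[of s]
      by (simp add: ennreal_add_left_cancel_less)
    finally show ?thesis .
  qed
  have W_pos: "0 < W s" if "s \<notin> T" for s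
    using W_super[OF that] W_nonneg[of s] by (cases "W s = 0") auto
  have W_T: "W s = 0" if "s \<in> T" for s
    using that by (simp add: W_def F_def G_def w_T v_T)
  have W_fin: "finite {s. s \<notin> T \<and> W s \<le> r}" for r
  proof -
    obtain K :: nat where K: "r < real K" using reals_Archimedean2 by blast
    \<comment> \<open>If the index of \<open>s\<close> exceeds this sum, each of the first
      \<open>K\<close> terms of \<open>F s\<close> equals 1. The sum is used because
      \<open>N\<close> need not be monotone.\<close>
    have "{s. s \<notin> T \<and> W s \<le> r} \<subseteq> {s. to_nat s \<le> (\<Sum>j<K. N j)}"
    proof (rule subsetI, rule ccontr)
      fix s assume s: "s \<in> {s. s \<notin> T \<and> W s \<le> r}" "s \<notin> {s. to_nat s \<le> (\<Sum>j<K. N j)}"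
      have "N j \<le> to_nat s" if "j < K" for j
        using member_le_sum[of j "{..<K}" N] that s(2) by simp
      then have "ennreal (real K) \<le> F s"
        using s by (intro F_ge) auto
      also have "\<dots> \<le> ennreal (W s)"
        unfolding W_eq by simp
      finally have "real K \<le> W s"
        using W_nonneg by (simp add: ennreal_le_iff)
      then show False using s K by simp
    qed
    moreover have "finite {s::'s. to_nat s \<le> (\<Sum>j<K. N j)}"
      using finite_vimageI[OF finite_atMost inj_to_nat] by (simp add: vimage_def)
    ultimately show ?thesis by (rule finite_subset)
  qed
  show ?thesis
    using W_nonneg W_T W_pos W_super W_fin by (intro exI[of _ W]) blast
qed

text \<open>Strict drift forces a successor \<open>x s\<close> of smaller value. Each sublevel set
  is finite, so the decrease and the probability of that successor have positive minima there; the
  minima shrink as the set grows with \<open>r\<close>.\<close>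

lemma progress_functions_exist:
  assumes W: "\<And>s. 0 \<le> W s"
    and super: "\<And>s. s \<notin> T \<Longrightarrow> (\<integral>\<^sup>+u. ennreal (W u) \<partial>P s) < ennreal (W s)"
    and fin: "\<And>r. finite {s. s \<notin> T \<and> W s \<le> r}"
  shows "\<exists>d q :: real \<Rightarrow> real. (\<forall>r. 0 < d r) \<and> (\<forall>r. 0 < q r \<and> q r \<le> 1) \<and>
    (\<forall>s. s \<notin> T \<longrightarrow> q (W s) \<le> measure_pmf.prob (P s) {s'. W s' \<le> W s - d (W s)}) \<and>
    antimono q \<and> antimono d"
proof -
  have "\<exists>x. x \<in> set_pmf (P s) \<and> W x < W s" if "s \<notin> T" for s
  proof (rule ccontr)
    assume "\<not> ?thesis"
    then have "\<And>x. x \<in> set_pmf (P s) \<Longrightarrow> W s \<le> W x"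
      by (auto simp: not_less)
    then have "(\<integral>\<^sup>+u. ennreal (W s) \<partial>P s) \<le> (\<integral>\<^sup>+u. ennreal (W u) \<partial>P s)"
      by (intro nn_integral_mono_AE) (auto simp: AE_measure_pmf_iff intro: ennreal_leI)
    then show False
      using super[OF that] by simp
  qed
  then obtain x where x: "\<And>s. s \<notin> T \<Longrightarrow> x s \<in> set_pmf (P s) \<and> W (x s) < W s"
    by metis
  define S where "S r = {s. s \<notin> T \<and> W s \<le> r}" for r
  \<comment> \<open>Inserting 1 keeps the minimum defined when \<open>S r\<close> is empty; in
    \<open>q\<close> it also gives the upper bound 1.\<close>
  define d where "d r = Min (insert 1 ((\<lambda>s. W s - W (x s)) ` S r))" for r
  define q where "q r = Min (insert 1 ((\<lambda>s. pmf (P s) (x s)) ` S r))" for r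
  have fin': "finite (S r)" for r
    using fin by (simp add: S_def)
  have "0 < d r" for r
    using fin' x by (auto simp: d_def S_def)
  moreover have "0 < q r" "q r \<le> 1" for r
    using fin' x by (auto simp: q_def S_def pmf_positive)
  moreover have "q (W s) \<le> measure_pmf.prob (P s) {s'. W s' \<le> W s - d (W s)}" if "s \<notin> T" for s
  proof -
    have s: "s \<in> S (W s)" using that by (simp add: S_def)
    have "q (W s) \<le> pmf (P s) (x s)"
      unfolding q_def using fin' s by (intro Min_le) auto
    also have "\<dots> = measure_pmf.prob (P s) {x s}"
      by (simp add: measure_pmf_single)
    also have "\<dots> \<le> measure_pmf.prob (P s) {s'. W s' \<le> W s - d (W s)}"
    proof (rule measure_pmf.finite_measure_mono)
      have "d (W s) \<le> W s - W (x s)"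
        unfolding d_def using fin' s by (intro Min_le) auto
      then show "{x s} \<subseteq> {s'. W s' \<le> W s - d (W s)}" by simp
    qed simp
    finally show ?thesis .
  qed
  moreover have "antimono q" "antimono d"
  proof -
    have "Min (insert 1 (f ` S r')) \<le> Min (insert 1 (f ` S r))" if "r \<le> r'"
      for f :: "'s \<Rightarrow> real" and r r'
    proof (rule Min_antimono)
      have "S r \<subseteq> S r'" using that by (auto simp: S_def)
      then show "insert 1 (f ` S r) \<subseteq> insert 1 (f ` S r')" by blast
    qed (simp_all add: fin')
    then show "antimono q" "antimono d"
      by (simp_all add: antimono_def q_def d_def)
  qed
  ultimately show ?thesis by blast
qed

section \<open>Certificates for a single pair\<close>

text \<open>These are the requirements for one pair \<open>(X, Y)\<close>, bundled because the pairs
  share only \<open>I\<close> and can be treated separately.\<close>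

definition Streett_certificate :: "'s set \<Rightarrow> 's set \<Rightarrow> 's set \<Rightarrow> 's set \<Rightarrow> ('s \<Rightarrow> real) \<Rightarrow>
    ('s \<Rightarrow> real) \<Rightarrow> (real \<Rightarrow> real) \<Rightarrow> (real \<Rightarrow> real) \<Rightarrow> bool" where
  "Streett_certificate I X Y J V W d q \<longleftrightarrow>
    J \<subseteq> I - X \<and> (\<forall>s. 0 \<le> V s) \<and> (\<forall>s. 0 \<le> W s) \<and>
    (\<forall>r\<ge>0. 0 < d r) \<and> (\<forall>r\<ge>0. 0 < q r \<and> q r \<le> 1) \<and>
    (\<forall>s. s \<notin> X \<longrightarrow> wsum (P s) V \<le> ennreal (V s)) \<and>
    (\<forall>s\<in>X. 1 \<le> V s) \<and>
    (\<exists>\<gamma>>0. \<forall>s\<in>J. V s \<le> 1 - \<gamma>) \<and>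
    (\<forall>s\<in>I - (Y \<union> J). 0 < W s \<and> wsum (P s) W \<le> ennreal (W s)) \<and>
    (\<forall>s\<in>I \<inter> (Y \<union> J). W s = 0) \<and>
    (\<forall>r>0. \<forall>s\<in>I - (Y \<union> J). W s = r \<longrightarrow>
      q r \<le> measure_pmf.prob (P s) {s'. W s' \<le> r - d r}) \<and>
    antimono_on {0<..} q \<and> antimono_on {0<..} d"

lemma Streett_certificate_exists:
  assumes "Acc \<in> sets path_space" "Acc \<subseteq> Fin X \<union> Inf_often Y" "c < 1"
    and I: "\<And>s. s \<in> I \<Longrightarrow> measure (chain_from s) (- Acc) < c"
  shows "\<exists>J V W d q. Streett_certificate I X Y J V W d q"
proof -
  let ?R = "{\<omega>::nat \<Rightarrow> 's. \<exists>n. \<omega> n \<in> X}"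
  define V where "V s = measure (chain_from s) ?R" for s
  define J where "J = {s\<in>I. V s \<le> 1/2}"
  \<comment> \<open>Including \<open>- I\<close> ensures that each state outside \<open>T\<close>
    has rejection probability below \<open>c\<close>. It also makes \<open>W\<close> vanish off
    \<open>I\<close>, where nothing more is asked of it than nonnegativity.\<close>
  define T where "T = Y \<union> J \<union> - I"
  have V_step: "ennreal (V s) = (\<integral>\<^sup>+u. emeasure (chain_from u) (case_nat s -` ?R) \<partial>P s)" for s
    unfolding V_def chain.emeasure_eq_measure[symmetric]
    by (rule emeasure_chain_from_step[OF reach_in_sets])
  have V_super: "wsum (P s) V \<le> ennreal (V s)" if "s \<notin> X" for s
  proof -
    have "case_nat s -` ?R = ?R"
    proof (intro set_eqI iffI)
      fix \<omega> assume "\<omega> \<in> case_nat s -` ?R"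
      then obtain n where "case_nat s \<omega> n \<in> X" by auto
      then show "\<omega> \<in> ?R" using that by (cases n) auto
    next
      fix \<omega> assume "\<omega> \<in> ?R"
      then obtain n where "\<omega> n \<in> X" by auto
      then show "\<omega> \<in> case_nat s -` ?R" by (auto intro!: exI[of _ "Suc n"])
    qed
    then show ?thesis
      unfolding V_step by (subst wsum_eq_nn_integral) (simp_all add: V_def chain.emeasure_eq_measure)
  qed
  have V_X: "V s = 1" if "s \<in> X" for s
  proof -
    have "case_nat s -` ?R = UNIV"
      using that by (auto intro!: exI[of _ 0])
    then have "ennreal (V s) = 1"
      using V_step[of s] chain.emeasure_space_1 by simp
    then show ?thesis by (simp add: V_def)
  qed
  have "emeasure (chain_from s) (stay (- T)) = 0" for s
    by (rule stay_null_of_acceptance[OF assms(1-3)])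
       (use I in \<open>auto simp: T_def J_def V_def\<close>)
  then obtain W where W: "\<And>s. 0 \<le> W s" "\<And>s. s \<in> T \<Longrightarrow> W s = 0" "\<And>s. s \<notin> T \<Longrightarrow> 0 < W s"
      "\<And>s. s \<notin> T \<Longrightarrow> (\<integral>\<^sup>+u. ennreal (W u) \<partial>P s) < ennreal (W s)"
      "\<And>r. finite {s. s \<notin> T \<and> W s \<le> r}"
    using Lyapunov_function_exists[of T] by blast
  obtain d q where dq: "\<And>r. 0 < d r" "\<And>r. 0 < q r \<and> q r \<le> 1"
      "\<And>s. s \<notin> T \<Longrightarrow> q (W s) \<le> measure_pmf.prob (P s) {s'. W s' \<le> W s - d (W s)}"
      "antimono q" "antimono d"
    using progress_functions_exist[of W T, OF W(1,4,5)] by blast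
  have "wsum (P s) W \<le> ennreal (W s)" if "s \<notin> T" for s
    using W(4)[OF that] W(1) by (simp add: wsum_eq_nn_integral)
  moreover have "antimono_on {0<..} q" "antimono_on {0<..} d"
    using dq(4,5) by (auto simp: monotone_on_def)
  moreover have "\<exists>\<gamma>>0. \<forall>s\<in>J. V s \<le> 1 - \<gamma>"
    by (rule exI[of _ "1/2"]) (auto simp: J_def)
  moreover have "J \<subseteq> I - X"
    using V_X by (auto simp: J_def)
  ultimately have "Streett_certificate I X Y J V W d q"
    unfolding Streett_certificate_def using W(1-3) dq(1-3) V_super V_X
    by (auto simp: T_def V_def)
  then show ?thesis by blast
qed

section \<open>Shift invariance and the global function\<close>

text \<open>Prepending a state only shifts time by one. Together with the complement rule for
  \<open>Inf_often\<close>, this makes acceptance a shift-invariant event.\<close>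

lemma vimage_case_nat_Fin: "case_nat s -` Fin X = Fin X"
proof (intro set_eqI iffI)
  fix \<omega> assume "\<omega> \<in> case_nat s -` Fin X"
  then obtain n where n: "\<And>m. n \<le> m \<Longrightarrow> case_nat s \<omega> m \<notin> X"
    by (auto simp: Fin_def)
  have "\<omega> m \<notin> X" if "n \<le> m" for m
    using n[of "Suc m"] that by simp
  then show "\<omega> \<in> Fin X" by (auto simp: Fin_def)
next
  fix \<omega> assume "\<omega> \<in> Fin X"
  then obtain n where n: "\<And>m. n \<le> m \<Longrightarrow> \<omega> m \<notin> X"
    by (auto simp: Fin_def)
  have "case_nat s \<omega> m \<notin> X" if "Suc n \<le> m" for m
    using n[of "m - 1"] that by (cases m) auto
  then show "\<omega> \<in> case_nat s -` Fin X"
    by (auto simp: Fin_def intro!: exI[of _ "Suc n"])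
qed

lemma Inf_often_eq_Compl_Fin: "Inf_often X = - Fin X"
  by (auto simp: Inf_often_def Fin_def)

end

theorem theorem4p9:
  fixes \<mu> :: "'s::countable pmf" and P :: "'s \<Rightarrow> 's pmf"
    and k :: nat and A B :: "nat \<Rightarrow> 's set" and p :: real
  assumes "0 < p" and "p \<le> 1"
    and "measure (chain_law \<mu> P) (\<Inter>i\<in>{1..k}. Fin (A i) \<union> Inf_often (B i)) = p"
  shows "\<forall>\<epsilon>>0. \<exists>(I :: 's set) (V0 :: 's \<Rightarrow> real) (J :: nat \<Rightarrow> 's set)
      (V :: nat \<Rightarrow> 's \<Rightarrow> real) (W :: nat \<Rightarrow> 's \<Rightarrow> real)
      (d :: nat \<Rightarrow> real \<Rightarrow> real) (q :: nat \<Rightarrow> real \<Rightarrow> real).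
    (\<forall>s. 0 \<le> V0 s) \<and>
    wsum \<mu> V0 \<le> ennreal (1 - p + \<epsilon>) \<and>
    (\<forall>i\<in>{1..k}.
      J i \<subseteq> I - A i \<and>
      (\<forall>s. 0 \<le> V i s) \<and>
      (\<forall>s. 0 \<le> W i s) \<and>
      (\<forall>r\<ge>0. 0 < d i r) \<and>
      (\<forall>r\<ge>0. 0 < q i r \<and> q i r \<le> 1) \<and>
      (\<forall>s. s \<notin> A i \<longrightarrow> wsum (P s) (V i) \<le> ennreal (V i s)) \<and>
      (\<forall>s\<in>A i. 1 \<le> V i s) \<and>
      (\<exists>\<gamma>>0. \<forall>s\<in>J i. V i s \<le> 1 - \<gamma>) \<and>
      (\<forall>s\<in>I - (B i \<union> J i). 0 < W i s \<and> wsum (P s) (W i) \<le> ennreal (W i s)) \<and>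
      (\<forall>s\<in>I \<inter> (B i \<union> J i). W i s = 0) \<and>
      (\<forall>r>0. \<forall>s\<in>I - (B i \<union> J i). W i s = r \<longrightarrow>
        q i r \<le> measure_pmf.prob (P s) {s'. W i s' \<le> r - d i r}) \<and>
      antimono_on {0<..} (q i) \<and> antimono_on {0<..} (d i)) \<and>
    (\<forall>s\<in>I. wsum (P s) V0 \<le> ennreal (V0 s)) \<and>
    (\<forall>s. s \<notin> I \<longrightarrow> 1 \<le> V0 s)"
proof (intro allI impI, goal_cases)
  case (1 \<epsilon>)
  then have \<epsilon>: "\<epsilon> > 0" .
  let ?Acc = "\<Inter>i\<in>{1..k}. Fin (A i) \<union> Inf_often (B i)"
  interpret \<mu>: prob_space "chain_law \<mu> P"
    by (rule prob_space_chain_law)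
  \<comment> \<open>Chosen so that \<open>1 / (1 - \<delta>) = 1 + \<epsilon>\<close>.\<close>
  define \<delta> where "\<delta> = \<epsilon> / (1 + \<epsilon>)"
  have \<delta>: "0 < \<delta>" "\<delta> < 1"
    using \<epsilon> by (auto simp: \<delta>_def)
  define g where "g s = measure (chain_from P s) (- ?Acc)" for s
  \<comment> \<open>The same threshold keeps rejection away from 1 on \<open>I\<close> and makes the
    rescaled \<open>V0\<close> at least 1 off \<open>I\<close>.\<close>
  define I where "I = {s. g s < 1 - \<delta>}"
  define V0 where "V0 s = g s / (1 - \<delta>)" for s
  have Acc_sets: "?Acc \<in> sets path_space"
  proof -
    have "{\<omega>. \<forall>i\<in>{1..k}. \<omega> \<in> Fin (A i) \<union> Inf_often (B i)} \<in> sets path_space"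
      by (rule path_event_in_sets) measurable
    moreover have "?Acc = {\<omega>. \<forall>i\<in>{1..k}. \<omega> \<in> Fin (A i) \<union> Inf_often (B i)}"
      by auto
    ultimately show ?thesis by simp
  qed
  then have nAcc_sets: "- ?Acc \<in> sets path_space"
    using sets.compl_sets[of ?Acc path_space] by (simp add: space_PiM Compl_eq_Diff_UNIV)
  have g_nonneg: "0 \<le> g s" for s
    by (simp add: g_def)
  have em: "emeasure (chain_from P s) (- ?Acc) = ennreal (g s)" for s
  proof -
    interpret prob_space "chain_from P s" by (rule prob_space_chain_law)
    show ?thesis by (simp add: g_def emeasure_eq_measure)
  qed
  \<comment> \<open>Shift invariance of acceptance gives equality, so the bound on \<open>V0\<close>
    holds at every state.\<close>
  have g_step: "(\<integral>\<^sup>+u. ennreal (g u) \<partial>P s) = ennreal (g s)" for s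
  proof -
    have "case_nat s -` (- ?Acc) = - ?Acc"
      unfolding Inf_often_eq_Compl_Fin
      by (simp only: vimage_Compl vimage_INT vimage_Un vimage_case_nat_Fin)
    then show ?thesis
      using emeasure_chain_from_step[OF nAcc_sets, where P = P and s = s] unfolding em by (simp only: em)
  qed
  have g_init: "(\<integral>\<^sup>+u. ennreal (g u) \<partial>\<mu>) = ennreal (1 - p)"
  proof -
    have "measure (chain_law \<mu> P) (- ?Acc) = 1 - p"
      using \<mu>.prob_compl[of ?Acc] Acc_sets assms(3)
      by (simp add: sets_chain_law Compl_eq_Diff_UNIV)
    then show ?thesis
      using emeasure_chain_law_initial[OF nAcc_sets, where P = P and \<mu> = \<mu>]
      unfolding em \<mu>.emeasure_eq_measure by simp
  qed
  have wsum_V0: "wsum D V0 = ennreal (1 / (1 - \<delta>)) * (\<integral>\<^sup>+u. ennreal (g u) \<partial>D)" for D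
  proof -
    have "wsum D V0 = (\<integral>\<^sup>+u. ennreal (1 / (1 - \<delta>)) * ennreal (g u) \<partial>D)"
      using g_nonneg \<delta>
      by (simp add: wsum_eq_nn_integral V0_def ennreal_mult'[symmetric])
    then show ?thesis by (simp add: nn_integral_cmult)
  qed
  have V0_init: "wsum \<mu> V0 \<le> ennreal (1 - p + \<epsilon>)"
  proof -
    have "wsum \<mu> V0 = ennreal ((1 - p) / (1 - \<delta>))"
      using \<delta> assms(2) unfolding wsum_V0 g_init by (simp add: ennreal_mult'[symmetric])
    also have "(1 - p) / (1 - \<delta>) = (1 - p) * (1 + \<epsilon>)"
      using \<epsilon> by (simp add: \<delta>_def field_simps)
    \<comment> \<open>The excess \<open>(1 - p) * \<epsilon>\<close> is at most
      \<open>\<epsilon>\<close> because \<open>p\<close> is positive.\<close>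
    also have "\<dots> \<le> 1 - p + \<epsilon>"
      using \<epsilon> assms(1) by (simp add: algebra_simps)
    finally show ?thesis by (simp add: ennreal_leI)
  qed
  have V0_step: "wsum (P s) V0 \<le> ennreal (V0 s)" for s
    using \<delta> g_nonneg unfolding wsum_V0 g_step by (simp add: V0_def ennreal_mult'[symmetric])
  have V0_nonneg: "0 \<le> V0 s" for s
    using \<delta> g_nonneg by (simp add: V0_def)
  have V0_I: "1 \<le> V0 s" if "s \<notin> I" for s
    using that \<delta> by (simp add: V0_def I_def field_simps)
  have "\<exists>J V W d q. Streett_certificate P I (A i) (B i) J V W d q" if "i \<in> {1..k}" for i
    by (rule Streett_certificate_exists[OF Acc_sets, of _ _ "1 - \<delta>"])
       (use that \<delta> in \<open>auto simp: I_def g_def\<close>)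
  then obtain J V W d q where
    cert: "\<forall>i\<in>{1..k}. Streett_certificate P I (A i) (B i) (J i) (V i) (W i) (d i) (q i)"
    by metis
  show ?case
    by (rule exI[of _ I], rule exI[of _ V0], rule exI[of _ J], rule exI[of _ V], rule exI[of _ W],
        rule exI[of _ d], rule exI[of _ q], intro conjI)
       (rule cert[unfolded Streett_certificate_def] | simp add: V0_init V0_step V0_nonneg V0_I)+
qed

end
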